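(* Let $k$ be a positive integer and $\Gamma$ a connected loopless $2k$-regular graph (parallel edges allowed). Then for any two vertices $v,v'\in V(\Gamma)$, the decompletions $\Gamma-v$ and $\Gamma-v'$ have equal graph permanents.
   Context: For a regular graph $\Gamma$ and $v\in V(\Gamma)$, the graph $\Gamma-v$ is a decompletion of $\Gamma$. Given a graph $G$ with an arbitrary orientation of its edges, its signed incidence matrix has rows indexed by vertices and columns by edges, with entry $1$ if the vertex is the tail of the edge, $-1$ if it is the head, $0$ otherwise; deleting the row of a chosen special vertex and stacking $k$ copies of the resulting matrix vertically gives a $k$DSI matrix of $G$. For a graph $G$ with $|E(G)|=k(|V(G)|-1)$, the graph permanent of $G$ is $\pm\mathrm{Perm}(M)\bmod (k+1)$ for a $k$DSI matrix $M$ of $G$, taken by convention as a residue in $[0,\frac{k+1}{2}]$; it does not depend on the choice of orientation or special vertex. Here $\mathrm{Perm}(A)=\sum_{\sigma\in S_n}\prod_i a_{i,\sigma(i)}$. *)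

theory Defs
  imports "Jordan_Normal_Form.Matrix" "HOL-Library.Uprod" "HOL-Combinatorics.Permutations"
begin

text \<open>
  Undirected multigraphs: edges are named objects, so parallel edges are distinct edges with
  the same unordered pair of ends; a loop at \<open>v\<close> is an edge with ends \<open>Upair v v\<close>.
\<close>

record ('v, 'e) multigraph =
  verts :: "'v set"
  edges :: "'e set"
  ends :: "'e \<Rightarrow> 'v uprod"

definition finite_multigraph :: "('v, 'e) multigraph \<Rightarrow> bool" where
  "finite_multigraph G \<longleftrightarrow> finite (verts G) \<and> finite (edges G)
     \<and> (\<forall>e\<in>edges G. set_uprod (ends G e) \<subseteq> verts G)"

definition loopless :: "('v, 'e) multigraph \<Rightarrow> bool" where
  "loopless G \<longleftrightarrow> (\<forall>e\<in>edges G. proper_uprod (ends G e))"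

text \<open>A loop contributes 2 to the degree of its vertex.\<close>

definition degree :: "('v, 'e) multigraph \<Rightarrow> 'v \<Rightarrow> nat" where
  "degree G v = card {e \<in> edges G. v \<in> set_uprod (ends G e)}
     + card {e \<in> edges G. ends G e = Upair v v}"

definition regular :: "nat \<Rightarrow> ('v, 'e) multigraph \<Rightarrow> bool" where
  "regular d G \<longleftrightarrow> (\<forall>v\<in>verts G. degree G v = d)"

definition adjacency :: "('v, 'e) multigraph \<Rightarrow> ('v \<times> 'v) set" where
  "adjacency G = {(u, w). \<exists>e\<in>edges G. ends G e = Upair u w}"

definition connected_graph :: "('v, 'e) multigraph \<Rightarrow> bool" where
  "connected_graph G \<longleftrightarrow> verts G \<noteq> {}
     \<and> (\<forall>u\<in>verts G. \<forall>w\<in>verts G. (u, w) \<in> (adjacency G)\<^sup>*)"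

definition delete_vertex :: "('v, 'e) multigraph \<Rightarrow> 'v \<Rightarrow> ('v, 'e) multigraph" where
  "delete_vertex G v =
     \<lparr>verts = verts G - {v},
      edges = {e \<in> edges G. v \<notin> set_uprod (ends G e)},
      ends = ends G\<rparr>"

definition orientation ::
    "('v, 'e) multigraph \<Rightarrow> ('e \<Rightarrow> 'v) \<Rightarrow> ('e \<Rightarrow> 'v) \<Rightarrow> bool" where
  "orientation G tail head \<longleftrightarrow> (\<forall>e\<in>edges G. ends G e = Upair (tail e) (head e))"

text \<open>
  The rows of the signed incidence matrix belonging to the vertices listed in \<open>vs\<close>, with columns
  ordered by \<open>es\<close>. The entry is 1 at the tail, -1 at the head and 0 otherwise; a loop would get a
  zero column.
\<close>

definition signed_incidence ::
    "('e \<Rightarrow> 'v) \<Rightarrow> ('e \<Rightarrow> 'v) \<Rightarrow> 'v list \<Rightarrow> 'e list \<Rightarrow> int mat" where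
  "signed_incidence tail head vs es =
     mat (length vs) (length es)
       (\<lambda>(i, j). of_bool (vs ! i = tail (es ! j)) - of_bool (vs ! i = head (es ! j)))"

definition stack_copies :: "nat \<Rightarrow> 'a mat \<Rightarrow> 'a mat" where
  "stack_copies k A = mat (k * dim_row A) (dim_col A) (\<lambda>(i, j). A $$ (i mod dim_row A, j))"

text \<open>
  \<open>M\<close> is a \<open>k\<close>DSI matrix of \<open>G\<close>: some orientation, some special vertex \<open>s\<close>, and some orders of the
  remaining vertices and of the edges produce it.
\<close>

definition kDSI_matrix :: "nat \<Rightarrow> ('v, 'e) multigraph \<Rightarrow> int mat \<Rightarrow> bool" where
  "kDSI_matrix k G M \<longleftrightarrow>
     (\<exists>tail head s vs es.
        orientation G tail head \<and> s \<in> verts G \<and>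
        distinct vs \<and> set vs = verts G - {s} \<and>
        distinct es \<and> set es = edges G \<and>
        M = stack_copies k (signed_incidence tail head vs es))"

text \<open>Meant for square matrices.\<close>

definition permanent :: "'a :: comm_semiring_1 mat \<Rightarrow> 'a" where
  "permanent A =
     (\<Sum>\<sigma> | \<sigma> permutes {0..<dim_row A}. \<Prod>i = 0..<dim_row A. A $$ (i, \<sigma> i))"

text \<open>The representative of \<open>\<plusminus>x\<close> modulo \<open>m\<close> in the interval \<open>[0, m/2]\<close>.\<close>

definition pm_residue :: "int \<Rightarrow> int \<Rightarrow> int" where
  "pm_residue m x = min (x mod m) ((- x) mod m)"

lemma pm_residue_unique:
  assumes "m > 0"
  shows "r = pm_residue m x \<longleftrightarrow>
    0 \<le> r \<and> 2 * r \<le> m \<and> (r mod m = x mod m \<or> r mod m = (- x) mod m)"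
proof -
  have neg: "(- x) mod m = (if x mod m = 0 then 0 else m - x mod m)"
    by (rule zmod_zminus1_eq_if)
  have bnd: "0 \<le> x mod m" "x mod m < m"
    using assms by auto
  have small: "r mod m = r" if "0 \<le> r" "2 * r \<le> m"
    using that assms by (intro mod_pos_pos_trivial) auto
  show ?thesis
  proof
    assume r: "r = pm_residue m x"
    then have "0 \<le> r" "2 * r \<le> m" "r = x mod m \<or> r = (- x) mod m"
      using neg bnd less_imp_le[OF bnd(2)] assms unfolding pm_residue_def
        by (auto simp: min_def split: if_splits)
    then show "0 \<le> r \<and> 2 * r \<le> m \<and> (r mod m = x mod m \<or> r mod m = (- x) mod m)"
      by auto
  next
    assume *: "0 \<le> r \<and> 2 * r \<le> m \<and> (r mod m = x mod m \<or> r mod m = (- x) mod m)"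
    then have "r = x mod m \<or> r = (- x) mod m"
      using small by auto
    then show "r = pm_residue m x"
      using * neg bnd assms unfolding pm_residue_def by (auto simp: min_def split: if_splits)
  qed
qed

text \<open>
  Meant for loopless graphs with \<open>|E(G)| = k (|V(G)| - 1)\<close>: their \<open>k\<close>DSI matrices are square, and
  the residue is the same for all of them, so the choice made here is immaterial.
\<close>

definition graph_permanent :: "nat \<Rightarrow> ('v, 'e) multigraph \<Rightarrow> int" where
  "graph_permanent k G = pm_residue (int k + 1) (permanent (SOME M. kDSI_matrix k G M))"

end

(*
Expanding the permanent of a kDSI matrix along its columns, each column (edge) picks a vertex. So the
permanent is (k!)^|W| times the coefficient of prod_{w in W} x_w^k in the product over the edges e
of the linear forms x_{tail e} - x_{head e}, with W the set of nonspecial vertices.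

Write q(a) for a! times the coefficient of x^a, that is, the partial derivative of order a of the
product. The sum of q(a + e_w) over all vertices w comes from the derivative in the direction
(1, ..., 1), which kills every linear form, so it is 0. Terms with an exponent k + 1 vanish modulo
k + 1 because of the factor a!; so moving one unit of exponent from one vertex to another, all
others having exponent k, changes the sign of q. Hence the special vertex does not matter, and v'
can serve for Gamma - v and v for Gamma - v'.

With these choices both permanents are, up to sign, coefficients for the whole graph Gamma: one
with exponents 2k at v and 0 at v' (all edges at v are forced to pick v), the other with v and v'
exchanged, and k at every other vertex in both. Letting each edge pick its other end exchanges
them, because Gamma is 2k-regular; each edge contributes a factor -1.
*)
theory Submission imports Defs begin

section \<open>Coefficients of products of linear forms\<close>

text \<open>Such an \<open>f\<close> records one term of the expanded product: factor
  \<open>e\<close> contributes the variable of \<open>f e\<close>. Extensionality makes each choice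
  exactly one function.\<close>

definition assignments :: "'e set \<Rightarrow> 'v set \<Rightarrow> ('v \<Rightarrow> nat) \<Rightarrow> ('e \<Rightarrow> 'v) set" where
  "assignments E V a = {f \<in> E \<rightarrow>\<^sub>E V. \<forall>w\<in>V. card {e \<in> E. f e = w} = a w}"

text \<open>The coefficient of \<open>\<Prod>w\<in>V. x w ^ a w\<close> in \<open>\<Prod>e\<in>E. \<Sum>w\<in>V. A e w * x w\<close>.\<close>

definition coef :: "'e set \<Rightarrow> 'v set \<Rightarrow> ('e \<Rightarrow> 'v \<Rightarrow> int) \<Rightarrow> ('v \<Rightarrow> nat) \<Rightarrow> int" where
  "coef E V A a = (\<Sum>f \<in> assignments E V a. \<Prod>e\<in>E. A e (f e))"

text \<open>The mixed partial derivative of order \<open>a\<close> of the product, taken at the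
  origin. The factorials count permutations of equally labelled rows, and later they supply
  divisibility by \<open>k + 1\<close>.\<close>

definition weighted_coef :: "'e set \<Rightarrow> 'v set \<Rightarrow> ('e \<Rightarrow> 'v \<Rightarrow> int) \<Rightarrow> ('v \<Rightarrow> nat) \<Rightarrow> int" where
  "weighted_coef E V A a = (\<Prod>w\<in>V. fact (a w)) * coef E V A a"

text \<open>The linear form of an edge, indexed by edges and vertices themselves and so free of any
  order of rows and columns.\<close>

definition incidence :: "('e \<Rightarrow> 'v) \<Rightarrow> ('e \<Rightarrow> 'v) \<Rightarrow> 'e \<Rightarrow> 'v \<Rightarrow> int" where
  "incidence tail head e w = of_bool (w = tail e) - of_bool (w = head e)"

lemma finite_assignments: "finite E \<Longrightarrow> finite V \<Longrightarrow> finite (assignments E V a)"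
  unfolding assignments_def by (simp add: finite_PiE)

lemma assignments_cong: "(\<And>w. w \<in> V \<Longrightarrow> a w = b w) \<Longrightarrow> assignments E V a = assignments E V b"
  unfolding assignments_def by auto

lemma weighted_coef_cong:
  "(\<And>w. w \<in> V \<Longrightarrow> a w = b w) \<Longrightarrow> weighted_coef E V A a = weighted_coef E V A b"
  unfolding weighted_coef_def coef_def using assignments_cong[of V a b E] by simp

section \<open>Permanents as weighted coefficients\<close>

text \<open>The fibres of \<open>h\<close> and \<open>g\<close> over each label are matched
  independently, and a fibre of size c allows c! matchings. The induction removes one element of
  \<open>J\<close> together with its image, hence the arbitrary \<open>I\<close>.\<close>

lemma card_bijections_over:
  assumes "finite J" "finite I" "finite V" "h \<in> J \<rightarrow> V" "g \<in> I \<rightarrow> V"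
    and "\<And>w. w \<in> V \<Longrightarrow> card {i \<in> I. g i = w} = card {j \<in> J. h j = w}"
  shows "card {\<tau> \<in> J \<rightarrow>\<^sub>E I. bij_betw \<tau> J I \<and> (\<forall>j\<in>J. g (\<tau> j) = h j)}
    = (\<Prod>w\<in>V. fact (card {j \<in> J. h j = w}))"
  using assms
proof (induction J arbitrary: I rule: finite_induct)
  case empty
  have "I = {}"
  proof (rule ccontr)
    assume "I \<noteq> {}"
    then obtain i where "i \<in> I" by blast
    then have "g i \<in> V" "i \<in> {i' \<in> I. g i' = g i}" using empty by auto
    with empty(5)[of "g i"] show False using \<open>finite I\<close> by auto
  qed
  then have "{\<tau> \<in> {} \<rightarrow>\<^sub>E I. bij_betw \<tau> {} I \<and> (\<forall>j\<in>{}. g (\<tau> j) = h j)} = {\<lambda>_. undefined}"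
    by (auto simp: bij_betw_def)
  then show ?case by simp
next
  case (insert x J)
  let ?S = "\<lambda>J I. {\<tau> \<in> J \<rightarrow>\<^sub>E I. bij_betw \<tau> J I \<and> (\<forall>j\<in>J. g (\<tau> j) = h j)}"
  let ?P = "\<Prod>w\<in>V. fact (card {j \<in> J. h j = w})"
  let ?C = "{i \<in> I. g i = h x}"
  have hx: "h x \<in> V" using insert by auto
  have cC: "card ?C = Suc (card {j \<in> J. h j = h x})"
  proof -
    have "{j \<in> insert x J. h j = h x} = insert x {j \<in> J. h j = h x}" by auto
    then show ?thesis using insert hx by simp
  qed
  have step: "card (?S J (I - {i})) = ?P" if i: "i \<in> ?C" for i
  proof (rule insert.IH)
    fix w assume w: "w \<in> V"
    have *: "card {i \<in> I. g i = w} = card {j \<in> insert x J. h j = w}"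
      using insert.prems(5)[OF w] .
    show "card {i' \<in> I - {i}. g i' = w} = card {j \<in> J. h j = w}"
    proof (cases "w = h x")
      case True
      have "{i' \<in> I - {i}. g i' = w} = ?C - {i}" using True by auto
      then show ?thesis using cC i insert True by simp
    next
      case False
      have "{i' \<in> I - {i}. g i' = w} = {i \<in> I. g i = w}"
        "{j \<in> insert x J. h j = w} = {j \<in> J. h j = w}"
        using False i by auto
      then show ?thesis using * by simp
    qed
  qed (use insert in auto)
  \<comment> \<open>A bijection on \<open>insert x J\<close> amounts to its value \<open>i\<close>
    at \<open>x\<close>, taken from the fibre \<open>?C\<close>, and a bijection from
    \<open>J\<close> onto the rest of \<open>I\<close>.\<close>
  have "bij_betw (\<lambda>(i, \<tau>). \<tau>(x := i)) (SIGMA i:?C. ?S J (I - {i})) (?S (insert x J) I)"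
  proof (rule bij_betw_byWitness[where f' = "\<lambda>\<tau>. (\<tau> x, \<tau>(x := undefined))"])
    show "\<forall>a\<in>SIGMA i:?C. ?S J (I - {i}).
        (\<lambda>\<tau>. (\<tau> x, \<tau>(x := undefined))) ((\<lambda>(i, \<tau>). \<tau>(x := i)) a) = a"
      using insert(2) by (auto simp: fun_eq_iff PiE_def extensional_def)
    show "\<forall>a'\<in>?S (insert x J) I.
        (\<lambda>(i, \<tau>). \<tau>(x := i)) ((\<lambda>\<tau>. (\<tau> x, \<tau>(x := undefined))) a') = a'"
      by auto
    show "(\<lambda>(i, \<tau>). \<tau>(x := i)) ` (SIGMA i:?C. ?S J (I - {i})) \<subseteq> ?S (insert x J) I"
    proof (rule image_subsetI)
      fix p assume "p \<in> (SIGMA i:?C. ?S J (I - {i}))"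
      then obtain i \<tau> where p: "p = (i, \<tau>)" and *: "i \<in> I" "g i = h x"
          "\<tau> \<in> J \<rightarrow>\<^sub>E I - {i}" "bij_betw \<tau> J (I - {i})" "\<forall>j\<in>J. g (\<tau> j) = h j"
        by blast
      have "bij_betw (\<tau>(x := i)) J (I - {i})"
        using *(4) insert(2) by (subst bij_betw_cong[of J _ \<tau>]) auto
      then have "bij_betw (\<tau>(x := i)) (insert x J) (insert i (I - {i}))"
        using insert(2) by (simp add: bij_betw_def inj_on_insert)
      moreover have "insert i (I - {i}) = I" using * by auto
      ultimately show "(\<lambda>(i, \<tau>). \<tau>(x := i)) p \<in> ?S (insert x J) I"
        unfolding p using * insert(2) by (auto simp: PiE_def extensional_def)
    qed
    show "(\<lambda>\<tau>. (\<tau> x, \<tau>(x := undefined))) ` ?S (insert x J) I \<subseteq> (SIGMA i:?C. ?S J (I - {i}))"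
    proof (rule image_subsetI)
      fix \<tau> assume "\<tau> \<in> ?S (insert x J) I"
      then have *: "\<tau> \<in> insert x J \<rightarrow>\<^sub>E I" "bij_betw \<tau> (insert x J) I"
        "\<forall>j\<in>insert x J. g (\<tau> j) = h j"
        by blast+
      have "bij_betw \<tau> J (I - {\<tau> x})"
        using *(2) insert(2) by (auto simp: bij_betw_def inj_on_def)
      then have b: "bij_betw (\<tau>(x := undefined)) J (I - {\<tau> x})"
        using insert(2) by (subst bij_betw_cong[of J _ \<tau>]) auto
      then have "\<tau>(x := undefined) \<in> J \<rightarrow> I - {\<tau> x}" by (rule bij_betw_imp_funcset)
      then show "(\<tau> x, \<tau>(x := undefined)) \<in> (SIGMA i:?C. ?S J (I - {i}))"
        using * b insert(2) by (auto simp: PiE_def extensional_def)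
    qed
  qed
  then have "card (?S (insert x J) I) = card (SIGMA i:?C. ?S J (I - {i}))"
    by (simp add: bij_betw_same_card)
  also have "\<dots> = (\<Sum>i\<in>?C. card (?S J (I - {i})))"
    using insert by (intro card_SigmaI) (auto intro!: finite_subset[OF _ finite_PiE[of J "\<lambda>_. I"]])
  also have "\<dots> = (\<Sum>i\<in>?C. ?P)" by (rule sum.cong[OF refl step])
  also have "\<dots> = Suc (card {j \<in> J. h j = h x}) * ?P" using cC by simp
  \<comment> \<open>Adding \<open>x\<close> changes only the factor at \<open>h x\<close>, where the
    argument of the factorial grows by one.\<close>
  also have "\<dots> = (\<Prod>w\<in>V. fact (card {j \<in> insert x J. h j = w}))"
  proof -
    have 1: "{j \<in> insert x J. h j = h x} = insert x {j \<in> J. h j = h x}" by auto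
    have 2: "(\<Prod>w\<in>V - {h x}. fact (card {j \<in> insert x J. h j = w})) =
        (\<Prod>w\<in>V - {h x}. fact (card {j \<in> J. h j = w}) :: nat)"
      by (intro prod.cong refl arg_cong[where f = fact] arg_cong[where f = card]) auto
    show ?thesis
      using insert(1,2) by (subst (1 2) prod.remove[OF insert(5) hx]) (simp only: 2 1, simp add: algebra_simps)
  qed
  finally show ?case .
qed

text \<open>Permutations are grouped by the labelling of columns that they induce. The summand
  depends only on that labelling, and \<open>card_bijections_over\<close> counts each group.\<close>

lemma permanent_labelled_rows:
  fixes M :: "int mat"
  assumes M: "dim_row M = N" "\<And>i j. i < N \<Longrightarrow> j < N \<Longrightarrow> M $$ (i, j) = A j (g i)"
    and V: "finite V" and g: "g \<in> {0..<N} \<rightarrow> V"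
    and a: "\<And>w. w \<in> V \<Longrightarrow> card {i \<in> {0..<N}. g i = w} = a w"
  shows "permanent M = weighted_coef {0..<N} V A a"
proof -
  let ?J = "{0..<N}"
  let ?lab = "\<lambda>\<sigma>. restrict (\<lambda>j. g (\<sigma> j)) ?J"
  let ?H = "assignments ?J V a"
  let ?m = "\<lambda>\<sigma>. \<Prod>j\<in>?J. A j (g (\<sigma> j))"
  have "permanent M = (\<Sum>\<sigma> | \<sigma> permutes ?J. \<Prod>i\<in>?J. M $$ (i, \<sigma> i))"
    unfolding permanent_def M ..
  \<comment> \<open>Inverting the permutation turns the product over rows into one over columns:
    column \<open>j\<close> now picks row \<open>\<sigma> j\<close>.\<close>
  also have "\<dots> = (\<Sum>\<sigma> | \<sigma> permutes ?J. \<Prod>i\<in>?J. M $$ (i, Hilbert_Choice.inv \<sigma> i))"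
    by (rule sum_permutations_inverse)
  also have "\<dots> = (\<Sum>\<sigma> | \<sigma> permutes ?J. ?m \<sigma>)"
  proof (rule sum.cong[OF refl])
    fix \<sigma> assume "\<sigma> \<in> {\<sigma>. \<sigma> permutes ?J}"
    then have \<sigma>: "\<sigma> permutes ?J" by simp
    have "(\<Prod>i\<in>?J. M $$ (i, Hilbert_Choice.inv \<sigma> i)) = (\<Prod>j\<in>?J. M $$ (\<sigma> j, Hilbert_Choice.inv \<sigma> (\<sigma> j)))"
      using prod.permute[OF \<sigma>, of "\<lambda>i. M $$ (i, Hilbert_Choice.inv \<sigma> i)"] by (simp add: o_def)
    also have "\<dots> = ?m \<sigma>"
      using permutes_in_image[OF \<sigma>] permutes_inverses[OF \<sigma>]
      by (intro prod.cong) (auto simp: M)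
    finally show "(\<Prod>i\<in>?J. M $$ (i, Hilbert_Choice.inv \<sigma> i)) = ?m \<sigma>" .
  qed
  also have "\<dots> = (\<Sum>h\<in>?H. \<Sum>\<sigma> | \<sigma> \<in> {\<sigma>. \<sigma> permutes ?J} \<and> ?lab \<sigma> = h. ?m \<sigma>)"
  proof (rule sum.group[symmetric])
    show "finite {\<sigma>. \<sigma> permutes ?J}" by (simp add: finite_permutations)
    show "finite ?H" using V by (simp add: finite_assignments)
    show "?lab ` {\<sigma>. \<sigma> permutes ?J} \<subseteq> ?H"
    proof (clarsimp simp only: image_subset_iff mem_Collect_eq)
      fix \<sigma> assume \<sigma>: "\<sigma> permutes ?J"
      have "card {j \<in> ?J. ?lab \<sigma> j = w} = a w" if "w \<in> V" for w
      proof -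
        have "bij_betw \<sigma> {j \<in> ?J. ?lab \<sigma> j = w} {i \<in> ?J. g i = w}"
        proof (rule bij_betw_byWitness[where f' = "Hilbert_Choice.inv \<sigma>"])
        qed (use permutes_in_image[OF \<sigma>] permutes_in_image[OF permutes_inv[OF \<sigma>]]
            permutes_inverses[OF \<sigma>] in auto)
        then show ?thesis using a[OF that] by (simp add: bij_betw_same_card)
      qed
      moreover have "?lab \<sigma> \<in> ?J \<rightarrow>\<^sub>E V" using g permutes_in_image[OF \<sigma>] by auto
      ultimately show "?lab \<sigma> \<in> ?H" unfolding assignments_def by blast
    qed
  qed
  also have "\<dots> = (\<Sum>h\<in>?H. (\<Prod>w\<in>V. fact (a w)) * (\<Prod>j\<in>?J. A j (h j)))"
  proof (rule sum.cong[OF refl])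
    fix h assume h: "h \<in> ?H"
    let ?T = "{\<sigma>. \<sigma> \<in> {\<sigma>. \<sigma> permutes ?J} \<and> ?lab \<sigma> = h}"
    let ?S = "{\<tau> \<in> ?J \<rightarrow>\<^sub>E ?J. bij_betw \<tau> ?J ?J \<and> (\<forall>j\<in>?J. g (\<tau> j) = h j)}"
    have "(\<Sum>\<sigma>\<in>?T. ?m \<sigma>) = (\<Sum>\<sigma>\<in>?T. \<Prod>j\<in>?J. A j (h j))"
      by (intro sum.cong prod.cong refl) auto
    also have "\<dots> = int (card ?T) * (\<Prod>j\<in>?J. A j (h j))" by simp
    \<comment> \<open>Permutations are the identity outside \<open>?J\<close>, extensional functions
      are \<open>undefined\<close> there; restriction translates between the two.\<close>
    also have "card ?T = card ?S"
    proof (rule bij_betw_same_card)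
      show "bij_betw (\<lambda>\<sigma>. restrict \<sigma> ?J) ?T ?S"
      proof (rule bij_betw_byWitness[where f' = "\<lambda>\<tau> x. if x \<in> ?J then \<tau> x else x"])
        show "\<forall>\<sigma>\<in>?T. (\<lambda>x. if x \<in> ?J then restrict \<sigma> ?J x else x) = \<sigma>"
          by (auto simp: fun_eq_iff permutes_def)
        show "\<forall>\<tau>\<in>?S. restrict (\<lambda>x. if x \<in> ?J then \<tau> x else x) ?J = \<tau>"
          by (auto simp: fun_eq_iff PiE_def extensional_def)
        show "(\<lambda>\<sigma>. restrict \<sigma> ?J) ` ?T \<subseteq> ?S"
          by (auto simp: permutes_imp_bij permutes_in_image)
        show "(\<lambda>\<tau> x. if x \<in> ?J then \<tau> x else x) ` ?S \<subseteq> ?T"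
        proof (rule image_subsetI)
          fix \<tau> assume "\<tau> \<in> ?S"
          then have *: "\<tau> \<in> ?J \<rightarrow>\<^sub>E ?J" "bij_betw \<tau> ?J ?J" "\<forall>j\<in>?J. g (\<tau> j) = h j"
            by blast+
          have "bij_betw (\<lambda>x. if x \<in> ?J then \<tau> x else x) ?J ?J"
            using *(2) by (subst bij_betw_cong[of ?J _ \<tau>]) auto
          then have "(\<lambda>x. if x \<in> ?J then \<tau> x else x) permutes ?J"
            by (rule bij_imp_permutes) auto
          moreover have "?lab (\<lambda>x. if x \<in> ?J then \<tau> x else x) = h"
            using *(3) h by (auto simp: fun_eq_iff assignments_def PiE_def extensional_def)
          ultimately show "(\<lambda>x. if x \<in> ?J then \<tau> x else x) \<in> ?T" by blast
        qed
      qed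
    qed
    also have "card ?S = (\<Prod>w\<in>V. fact (card {j \<in> ?J. h j = w}))"
      using h a g V by (intro card_bijections_over) (auto simp: assignments_def)
    also have "\<dots> = (\<Prod>w\<in>V. fact (a w))"
      using h by (intro prod.cong) (auto simp: assignments_def)
    finally show "(\<Sum>\<sigma>\<in>?T. ?m \<sigma>) = (\<Prod>w\<in>V. fact (a w)) * (\<Prod>j\<in>?J. A j (h j))"
      by (simp only: of_nat_prod of_nat_fact)
  qed
  finally show ?thesis
    unfolding weighted_coef_def coef_def by (simp add: sum_distrib_left)
qed

text \<open>Renaming the factors changes nothing; this passes from column positions to
  edges.\<close>

lemma coef_reindex:
  assumes b: "bij_betw b J E"
  shows "coef J V (\<lambda>j. A (b j)) a = coef E V A a"
  unfolding coef_def
proof (rule sum.reindex_bij_witness[where i = "\<lambda>f. restrict (\<lambda>j. f (b j)) J"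
      and j = "\<lambda>f. restrict (\<lambda>e. f (inv_into J b e)) E"])
  let ?b' = "inv_into J b"
  have b': "bij_betw ?b' E J" using b by (rule bij_betw_inv_into)
  have 1: "?b' (b j) = j" "b j \<in> E" if "j \<in> J" for j
    using b that by (auto simp: bij_betw_inv_into_left bij_betwE)
  have 2: "b (?b' e) = e" "?b' e \<in> J" if "e \<in> E" for e
    using b b' that by (auto simp: bij_betw_inv_into_right bij_betwE)
  show "restrict (\<lambda>j. restrict (\<lambda>e. f (?b' e)) E (b j)) J = f" if "f \<in> assignments J V a" for f
    using that 1 by (auto simp: fun_eq_iff assignments_def PiE_def extensional_def)
  show "restrict (\<lambda>e. restrict (\<lambda>j. f (b j)) J (?b' e)) E = f" if "f \<in> assignments E V a" for f
    using that 2 by (auto simp: fun_eq_iff assignments_def PiE_def extensional_def)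
  show "restrict (\<lambda>e. f (?b' e)) E \<in> assignments E V a" if f: "f \<in> assignments J V a" for f
  proof -
    have "card {e \<in> E. f (?b' e) = w} = card {j \<in> J. f j = w}" for w
      by (rule bij_betw_same_card[of ?b'], rule bij_betw_byWitness[where f' = b]) (use 1 2 in auto)
    then show ?thesis using f 2 by (auto simp: assignments_def cong: conj_cong)
  qed
  show "restrict (\<lambda>j. f (b j)) J \<in> assignments J V a" if f: "f \<in> assignments E V a" for f
  proof -
    have "card {j \<in> J. f (b j) = w} = card {e \<in> E. f e = w}" for w
      by (rule bij_betw_same_card[of b], rule bij_betw_byWitness[where f' = ?b']) (use 1 2 in auto)
    then show ?thesis using f 1 by (auto simp: assignments_def cong: conj_cong)
  qed
  show "(\<Prod>e\<in>E. A e (restrict (\<lambda>e. f (?b' e)) E e)) = (\<Prod>j\<in>J. A (b j) (f j))" for f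
    by (subst prod.reindex_bij_betw[OF b, symmetric]) (auto intro!: prod.cong simp: 1)
qed

text \<open>The solutions are \<open>q * n + p\<close>, one for each \<open>q < k\<close>: a row of
  the unstacked matrix occurs once in each of the \<open>k\<close> copies.\<close>

lemma card_mod_eq:
  assumes "p < n"
  shows "card {i \<in> {0..<k * n}. i mod n = p} = k"
proof -
  have "bij_betw (\<lambda>q. q * n + p) {0..<k} {i \<in> {0..<k * n}. i mod n = p}"
  proof (rule bij_betw_byWitness[where f' = "\<lambda>i. i div n"])
    show "(\<lambda>q. q * n + p) ` {0..<k} \<subseteq> {i \<in> {0..<k * n}. i mod n = p}"
    proof (rule image_subsetI)
      fix q assume "q \<in> {0..<k}"
      then have "Suc q * n \<le> k * n" by (intro mult_le_mono1) simp
      then have "q * n + p < k * n" using assms by simp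
      then show "q * n + p \<in> {i \<in> {0..<k * n}. i mod n = p}" using assms by simp
    qed
  qed (use assms in \<open>auto simp: less_mult_imp_div_less\<close>)
  then show ?thesis using bij_betw_same_card by fastforce
qed

text \<open>Row \<open>i\<close> of the stack carries the label
  \<open>vs ! (i mod length vs)\<close>. Each vertex labels exactly \<open>k\<close> rows, so every
  exponent is \<open>k\<close>.\<close>

lemma permanent_stack_signed_incidence:
  assumes "distinct vs" "distinct es" "length es = k * length vs"
  shows "permanent (stack_copies k (signed_incidence tail head vs es)) =
    weighted_coef (set es) (set vs) (incidence tail head) (\<lambda>_. k)"
proof -
  let ?n = "length vs" and ?N = "k * length vs"
  let ?M = "stack_copies k (signed_incidence tail head vs es)"
  have dv: "i mod ?n < ?n" if "i < ?N" for i
    using that by (cases "?n = 0") auto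
  have "permanent ?M = weighted_coef {0..<?N} (set vs) (\<lambda>j. incidence tail head (es ! j)) (\<lambda>_. k)"
  proof (rule permanent_labelled_rows[where g = "\<lambda>i. vs ! (i mod ?n)"])
    show "dim_row ?M = ?N" by (simp add: stack_copies_def signed_incidence_def)
    show "?M $$ (i, j) = incidence tail head (es ! j) (vs ! (i mod ?n))" if "i < ?N" "j < ?N" for i j
      using that dv assms
      by (simp add: stack_copies_def signed_incidence_def incidence_def)
    show "(\<lambda>i. vs ! (i mod ?n)) \<in> {0..<?N} \<rightarrow> set vs" using dv by simp
    fix w assume "w \<in> set vs"
    then obtain p where p: "p < ?n" "vs ! p = w" by (auto simp: in_set_conv_nth)
    then have "{i \<in> {0..<?N}. vs ! (i mod ?n) = w} = {i \<in> {0..<?N}. i mod ?n = p}"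
      using dv assms(1) by (auto simp: nth_eq_iff_index_eq)
    then show "card {i \<in> {0..<?N}. vs ! (i mod ?n) = w} = k" using card_mod_eq[OF p(1)] by simp
  qed simp
  moreover have "bij_betw ((!) es) {0..<?N} (set es)"
    using assms by (intro bij_betw_nth) auto
  ultimately show ?thesis
    unfolding weighted_coef_def using coef_reindex by fastforce
qed

section \<open>Directional derivatives and the change of special vertex\<close>

text \<open>Compares coefficients in the partial derivative with respect to \<open>x w\<close>.\<close>

lemma Suc_mult_coef:
  assumes "finite E" "finite V" "w \<in> V"
  shows "int (Suc (a w)) * coef E V A (a(w := Suc (a w))) =
    (\<Sum>e\<in>E. A e w * coef (E - {e}) V A a)"
proof -
  let ?a = "a(w := Suc (a w))"
  let ?H = "assignments E V ?a"
  have fin: "finite ?H" using assms by (simp add: finite_assignments)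
  \<comment> \<open>The factor \<open>Suc (a w)\<close> is the number of edges that choose
    \<open>w\<close>, so it becomes a sum over a marked edge among them.\<close>
  have "int (Suc (a w)) * coef E V A ?a =
      (\<Sum>f\<in>?H. \<Sum>e | e \<in> E \<and> f e = w. \<Prod>d\<in>E. A d (f d))"
    unfolding coef_def sum_distrib_left
    by (rule sum.cong) (use assms in \<open>auto simp: assignments_def\<close>)
  also have "\<dots> = (\<Sum>e\<in>E. \<Sum>f | f \<in> ?H \<and> f e = w. \<Prod>d\<in>E. A d (f d))"
    using fin assms by (intro sum.swap_restrict)
  also have "\<dots> = (\<Sum>e\<in>E. A e w * coef (E - {e}) V A a)"
  proof (rule sum.cong[OF refl])
    fix e assume e: "e \<in> E"
    have del: "card {d \<in> E - {e}. g d = u} = a u"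
      if "u \<in> V" "g e = w" "\<And>u. u \<in> V \<Longrightarrow> card {d \<in> E. g d = u} = ?a u" for u and g :: "'a \<Rightarrow> 'b"
    proof -
      have "{d \<in> E - {e}. g d = u} = {d \<in> E. g d = u} - {e}" by auto
      then show ?thesis using that(3)[OF that(1)] that(2) e assms(1) by (cases "u = w") auto
    qed
    have ins: "card {d \<in> E. g d = u} = ?a u"
      if "u \<in> V" "g e = w" "\<And>u. u \<in> V \<Longrightarrow> card {d \<in> E - {e}. g d = u} = a u" for u and g :: "'a \<Rightarrow> 'b"
    proof -
      have "{d \<in> E. g d = u} = (if u = w then insert e {d \<in> E - {e}. g d = u} else {d \<in> E - {e}. g d = u})"
        using e that(2) by auto
      then show ?thesis using that(3)[OF that(1)] assms(1) by auto
    qed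
    \<comment> \<open>With \<open>e\<close> fixed to choose \<open>w\<close>, deleting
      \<open>e\<close> brings the exponent at \<open>w\<close> back to \<open>a w\<close>; the
      witness restores the choice.\<close>
    have "(\<Sum>f | f \<in> ?H \<and> f e = w. \<Prod>d\<in>E. A d (f d)) =
        (\<Sum>f\<in>assignments (E - {e}) V a. A e w * (\<Prod>d\<in>E - {e}. A d (f d)))"
    proof (rule sum.reindex_bij_witness[where i = "\<lambda>f. f(e := w)" and j = "\<lambda>f. f(e := undefined)"])
      fix f assume f: "f \<in> {f \<in> ?H. f e = w}"
      then show "(f(e := undefined))(e := w) = f" by auto
      have "{d \<in> E - {e}. (f(e := undefined)) d = u} = {d \<in> E - {e}. f d = u}" for u by auto
      moreover have "card {d \<in> E - {e}. f d = u} = a u" if "u \<in> V" for u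
        using that f by (intro del) (auto simp: assignments_def)
      ultimately show "f(e := undefined) \<in> assignments (E - {e}) V a"
        using f by (auto simp: assignments_def PiE_def extensional_def)
      have "(\<Prod>d\<in>E - {e}. A d ((f(e := undefined)) d)) = (\<Prod>d\<in>E - {e}. A d (f d))"
        by (rule prod.cong) auto
      then show "A e w * (\<Prod>d\<in>E - {e}. A d ((f(e := undefined)) d)) = (\<Prod>d\<in>E. A d (f d))"
        using f e assms(1) by (subst prod.remove[of E e]) auto
    next
      fix f assume f: "f \<in> assignments (E - {e}) V a"
      then show "(f(e := w))(e := undefined) = f"
        by (auto simp: assignments_def PiE_def extensional_def)
      have "{d \<in> E - {e}. (f(e := w)) d = u} = {d \<in> E - {e}. f d = u}" for u by auto
      then have "card {d \<in> E. (f(e := w)) d = u} = ?a u" if "u \<in> V" for u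
        using that f by (intro ins) (auto simp: assignments_def)
      moreover have "f(e := w) \<in> E \<rightarrow>\<^sub>E V"
        using f e assms(3) by (auto simp: assignments_def PiE_def extensional_def)
      ultimately show "f(e := w) \<in> {f \<in> ?H. f e = w}"
        unfolding assignments_def by simp
    qed
    then show "(\<Sum>f | f \<in> ?H \<and> f e = w. \<Prod>d\<in>E. A d (f d)) = A e w * coef (E - {e}) V A a"
      unfolding coef_def by (simp add: sum_distrib_left)
  qed
  finally show ?thesis .
qed

text \<open>By the product rule, the sum is a combination over edges \<open>e\<close> of
  coefficients of the product without \<open>e\<close>, each multiplied by the column sum of
  \<open>A\<close> at \<open>e\<close>.\<close>

lemma sum_weighted_coef_raise_eq_0:
  assumes "finite E" "finite V" "\<And>e. e \<in> E \<Longrightarrow> (\<Sum>w\<in>V. A e w) = 0"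
  shows "(\<Sum>w\<in>V. weighted_coef E V A (a(w := Suc (a w)))) = 0"
proof -
  let ?P = "\<Prod>u\<in>V. fact (a u) :: int"
  have "weighted_coef E V A (a(w := Suc (a w))) = ?P * (\<Sum>e\<in>E. A e w * coef (E - {e}) V A a)"
    if w: "w \<in> V" for w
  proof -
    \<comment> \<open>Raising the exponent at \<open>w\<close> multiplies the weight by
      \<open>Suc (a w)\<close>, exactly the factor that \<open>Suc_mult_coef\<close> asks
      for.\<close>
    have "(\<Prod>u\<in>V. fact ((a(w := Suc (a w))) u) :: int) =
        fact (Suc (a w)) * (\<Prod>u\<in>V - {w}. fact (a u))"
      using assms(2) w by (subst prod.remove[of V w]) (auto intro!: prod.cong)
    also have "\<dots> = int (Suc (a w)) * ?P"
      using prod.remove[OF assms(2) w, of "\<lambda>u. fact (a u) :: int"] by (simp add: algebra_simps)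
    finally show ?thesis
      unfolding weighted_coef_def using Suc_mult_coef[OF assms(1,2) w, of a A]
      by (simp add: mult.assoc mult.left_commute)
  qed
  then have "(\<Sum>w\<in>V. weighted_coef E V A (a(w := Suc (a w)))) =
      ?P * (\<Sum>w\<in>V. \<Sum>e\<in>E. A e w * coef (E - {e}) V A a)"
    by (simp add: sum_distrib_left)
  also have "(\<Sum>w\<in>V. \<Sum>e\<in>E. A e w * coef (E - {e}) V A a) =
      (\<Sum>e\<in>E. (\<Sum>w\<in>V. A e w) * coef (E - {e}) V A a)"
    by (subst sum.swap) (simp add: sum_distrib_right)
  also have "\<dots> = 0" using assms(3) by (intro sum.neutral) simp
  finally show ?thesis by (simp only: mult_zero_right)
qed

text \<open>The weight contains \<open>fact (Suc k)\<close>, a multiple of \<open>k + 1\<close>,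
  whatever the coefficient is.\<close>

lemma dvd_weighted_coef:
  assumes "finite V" "w \<in> V" "a w = Suc k"
  shows "int k + 1 dvd weighted_coef E V A a"
proof -
  have "fact (a w) = (int k + 1) * fact k" using assms by (simp add: algebra_simps)
  then have "int k + 1 dvd fact (a w)" by simp
  also have "fact (a w) dvd (\<Prod>u\<in>V. fact (a u) :: int)" using assms by (intro dvd_prodI)
  finally show ?thesis unfolding weighted_coef_def by simp
qed

lemma weighted_coef_change_special:
  assumes "finite E" "finite V" "\<And>e. e \<in> E \<Longrightarrow> (\<Sum>w\<in>V. A e w) = 0"
    and "s \<in> V" "s' \<in> V"
  shows "\<exists>c\<in>{1, -1}. int k + 1 dvd
    weighted_coef E V A ((\<lambda>_. k)(s := 0)) - c * weighted_coef E V A ((\<lambda>_. k)(s' := 0))"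
proof (cases "s = s'")
  case True
  then show ?thesis by (intro bexI[of _ 1]) auto
next
  case False
  \<comment> \<open>The exponents at \<open>s\<close> and \<open>s'\<close> always add up to
    \<open>k\<close>; \<open>m = 0\<close> makes \<open>s\<close> special and \<open>m = k\<close>
    makes \<open>s'\<close> special.\<close>
  let ?b = "\<lambda>m. (\<lambda>_. k)(s := m, s' := k - m)"
  let ?q = "\<lambda>m. weighted_coef E V A (?b m)"
  have step: "int k + 1 dvd ?q (Suc m) + ?q m" if m: "m < k" for m
  proof -
    \<comment> \<open>One unit short of both \<open>?b m\<close> and \<open>?b (Suc m)\<close>:
      raising \<open>s'\<close> gives the former, raising \<open>s\<close> the latter.\<close>
    let ?a = "(\<lambda>_. k)(s := m, s' := k - Suc m)"
    let ?t = "\<lambda>w. weighted_coef E V A (?a(w := Suc (?a w)))"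
    have a: "?a(s := Suc (?a s)) = ?b (Suc m)" "?a(s' := Suc (?a s')) = ?b m"
      using False m by (auto simp: Suc_diff_Suc)
    have "0 = (\<Sum>w\<in>V. ?t w)"
      using sum_weighted_coef_raise_eq_0[where A = A and a = ?a, OF assms(1-3)] by simp
    also have "\<dots> = ?t s + (\<Sum>w\<in>V - {s}. ?t w)"
      using assms by (intro sum.remove)
    also have "(\<Sum>w\<in>V - {s}. ?t w) = ?t s' + (\<Sum>w\<in>V - {s} - {s'}. ?t w)"
      using assms False by (intro sum.remove) auto
    finally have "?q (Suc m) + ?q m = - (\<Sum>w\<in>V - {s} - {s'}. ?t w)"
      unfolding a by linarith
    \<comment> \<open>At every other vertex the exponent is raised from \<open>k\<close> to
      \<open>k + 1\<close>.\<close>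
    moreover have "int k + 1 dvd (\<Sum>w\<in>V - {s} - {s'}. ?t w)"
      using assms(2) by (intro dvd_sum dvd_weighted_coef) auto
    ultimately show ?thesis by simp
  qed
  \<comment> \<open>Each moved unit costs one sign, so the whole passage from \<open>s\<close> to
    \<open>s'\<close> yields \<open>c = (-1) ^ k\<close>.\<close>
  have "int k + 1 dvd ?q 0 - (-1) ^ m * ?q m" if "m \<le> k" for m
    using that
  proof (induction m)
    case (Suc m)
    have "int k + 1 dvd ?q 0 - (-1) ^ m * ?q m" by (rule Suc.IH) (use Suc.prems in simp)
    moreover have "int k + 1 dvd (-1) ^ m * (?q (Suc m) + ?q m)"
      by (rule dvd_mult[OF step]) (use Suc.prems in simp)
    ultimately have "int k + 1 dvd ?q 0 - (-1) ^ m * ?q m + (-1) ^ m * (?q (Suc m) + ?q m)"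
      by (rule dvd_add)
    then show ?case by (simp add: algebra_simps del: fun_upd_apply)
  qed simp
  from this[of k] have "int k + 1 dvd ?q 0 - (-1) ^ k * ?q k" by simp
  moreover have "?b 0 = (\<lambda>_. k)(s := 0)" "?b k = (\<lambda>_. k)(s' := 0)" using False by auto
  moreover have "(-1) ^ k \<in> {1, -1 :: int}" by (cases "even k") auto
  ultimately show ?thesis by (metis (no_types, lifting))
qed

section \<open>Independence of special vertex and orientation\<close>

text \<open>Exponent 0 forbids every edge to choose \<open>s\<close>, and \<open>fact 0 = 1\<close>.
  A deleted row thus becomes a zero exponent, so different special vertices can be compared over one
  vertex set.\<close>

lemma weighted_coef_drop_vertex:
  assumes "finite E" "finite V" "s \<in> V"
  shows "weighted_coef E V A (a(s := 0)) = weighted_coef E (V - {s}) A a"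
proof -
  have "assignments E V (a(s := 0)) = assignments E (V - {s}) a" (is "?L = ?R")
  proof (intro equalityI subsetI)
    fix f assume f: "f \<in> ?L"
    then have "card {e \<in> E. f e = s} = 0" using assms(3) by (auto simp: assignments_def)
    then have "{e \<in> E. f e = s} = {}" using assms(1) by simp
    then show "f \<in> ?R" using f by (auto simp: assignments_def PiE_iff)
  next
    fix f assume f: "f \<in> ?R"
    then have "{e \<in> E. f e = s} = {}" by (auto simp: assignments_def)
    then have "card {e \<in> E. f e = s} = 0" by (simp only: card.empty)
    then show "f \<in> ?L" using f by (auto simp: assignments_def PiE_iff)
  qed
  moreover have "(\<Prod>w\<in>V. fact ((a(s := 0)) w)) = (\<Prod>w\<in>V - {s}. fact (a w) :: int)"
    using assms by (subst prod.remove[of V s]) (auto intro!: prod.cong)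
  ultimately show ?thesis unfolding weighted_coef_def coef_def by simp
qed

lemma prod_signs: "(\<And>e. e \<in> E \<Longrightarrow> c e \<in> {1, -1}) \<Longrightarrow> (\<Prod>e\<in>E. c e) \<in> {1, -1 :: int}"
proof (induction E rule: infinite_finite_induct)
  case (insert e E)
  then have "c e \<in> {1, -1}" "(\<Prod>e\<in>E. c e) \<in> {1, -1}" by blast+
  then show ?case using insert(1,2) by auto
qed auto

text \<open>Reversing an edge negates its linear form, so two orientations differ by a product of
  signs.\<close>

lemma weighted_coef_change_orientation:
  assumes "\<And>e. e \<in> E \<Longrightarrow> Upair (tail e) (head e) = Upair (tail' e) (head' e)"
  shows "\<exists>c\<in>{1, -1}. weighted_coef E V (incidence tail head) a =
    c * weighted_coef E V (incidence tail' head') a"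
proof
  \<comment> \<open>Since the ends agree as unordered pairs, differing tails mean that the edge is
    reversed; a loop receives the sign 1.\<close>
  let ?c = "\<lambda>e. if tail e = tail' e then 1 else -1 :: int"
  have *: "incidence tail head e w = ?c e * incidence tail' head' e w" if "e \<in> E" for e w
    using assms[OF that] by (auto simp: incidence_def)
  show "weighted_coef E V (incidence tail head) a =
      (\<Prod>e\<in>E. ?c e) * weighted_coef E V (incidence tail' head') a"
    unfolding weighted_coef_def coef_def by (simp add: * prod.distrib sum_distrib_left mult.left_commute)
  show "(\<Prod>e\<in>E. ?c e) \<in> {1, -1}" by (rule prod_signs) simp
qed

lemma pm_residue_cong:
  assumes "c \<in> {1, -1}" "m dvd x - c * y"
  shows "pm_residue m x = pm_residue m y"
proof -
  have "x mod m = (c * y) mod m" using assms by (simp add: mod_eq_dvd_iff)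
  moreover from this have "(- x) mod m = (- (c * y)) mod m" by (rule mod_minus_cong)
  ultimately show ?thesis using assms(1) by (auto simp: pm_residue_def min.commute)
qed

text \<open>Frees the graph permanent from the arbitrary matrix in its definition: changing the
  special vertex or the orientation costs only a sign modulo \<open>k + 1\<close>, which
  \<open>pm_residue\<close> ignores.\<close>

lemma graph_permanent_eq:
  assumes G: "finite_multigraph G" and ori: "orientation G tail head" and s: "s \<in> verts G"
    and card: "card (edges G) = k * (card (verts G) - 1)"
  shows "graph_permanent k G =
    pm_residue (int k + 1) (weighted_coef (edges G) (verts G - {s}) (incidence tail head) (\<lambda>_. k))"
proof -
  let ?E = "edges G" and ?V = "verts G"
  let ?a = "\<lambda>s. (\<lambda>_. k)(s := 0)"
  have fin: "finite ?E" "finite ?V" using G by (auto simp: finite_multigraph_def)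
  obtain vs where "set vs = ?V - {s}" "distinct vs"
    using fin finite_distinct_list by (metis finite_Diff)
  moreover obtain es where "set es = ?E" "distinct es" using fin finite_distinct_list by metis
  ultimately have "\<exists>M. kDSI_matrix k G M" unfolding kDSI_matrix_def using ori s by blast
  then have "kDSI_matrix k G (SOME M. kDSI_matrix k G M)" by (rule someI_ex)
  then obtain tail' head' s' vs es where M: "orientation G tail' head'" "s' \<in> ?V"
      "distinct vs" "set vs = ?V - {s'}" "distinct es" "set es = ?E"
      "(SOME M. kDSI_matrix k G M) = stack_copies k (signed_incidence tail' head' vs es)"
    unfolding kDSI_matrix_def by metis
  \<comment> \<open>The edge count makes the chosen matrix square.\<close>
  have "length es = k * length vs"
    using M fin card distinct_card[of es] distinct_card[of vs] by simp
  then have perm: "permanent (SOME M. kDSI_matrix k G M) = weighted_coef ?E ?V (incidence tail' head') (?a s')"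
    using M fin by (simp add: permanent_stack_signed_incidence weighted_coef_drop_vertex)
  have up: "ends G e = Upair (tail e) (head e)" "ends G e = Upair (tail' e) (head' e)" if "e \<in> ?E" for e
    using that ori M(1) unfolding orientation_def by blast+
  \<comment> \<open>The entries 1 and -1 cancel only when the sum runs over all vertices, which is
    why the special vertex was put back with exponent 0.\<close>
  have cols: "(\<Sum>w\<in>?V. incidence tail' head' e w) = 0" if "e \<in> ?E" for e
  proof -
    have "tail' e \<in> ?V" "head' e \<in> ?V"
      using G that up(2)[OF that] by (auto simp: finite_multigraph_def dest!: bspec)
    then show ?thesis using fin by (simp add: incidence_def sum_subtractf of_bool_def)
  qed
  obtain c where c: "c \<in> {1, -1}" "int k + 1 dvd weighted_coef ?E ?V (incidence tail' head') (?a s') -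
      c * weighted_coef ?E ?V (incidence tail' head') (?a s)"
    using weighted_coef_change_special[where k = k and A = "incidence tail' head'", OF fin _ M(2) s] cols by blast
  obtain d where d: "d \<in> {1, -1}" "weighted_coef ?E ?V (incidence tail' head') (?a s) =
      d * weighted_coef ?E ?V (incidence tail head) (?a s)"
    using weighted_coef_change_orientation[of ?E tail' head' tail head ?V "?a s"] up by metis
  have "graph_permanent k G = pm_residue (int k + 1) (weighted_coef ?E ?V (incidence tail head) (?a s))"
    unfolding graph_permanent_def perm
    by (rule pm_residue_cong[of "c * d"]) (use c d in \<open>auto simp: mult.assoc\<close>)
  then show ?thesis using fin s by (simp add: weighted_coef_drop_vertex)
qed

section \<open>Forced choices and exchange of ends\<close>

text \<open>Only the factors in \<open>D\<close> involve the variable of \<open>v\<close>. Exponent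
  \<open>card D\<close> there forces all of them to choose \<open>v\<close>, and the remaining
  factors choose elsewhere.\<close>

lemma coef_saturated_vertex:
  assumes "finite E" "finite V" "v \<in> V" and D: "D = {e \<in> E. A e v \<noteq> 0}" and av: "a v = card D"
  shows "coef E V A a = (\<Prod>e\<in>D. A e v) * coef (E - D) (V - {v}) A a"
proof -
  let ?S = "{f \<in> assignments E V a. \<forall>e\<in>E. f e = v \<longleftrightarrow> e \<in> D}"
  have sub: "D \<subseteq> E" using D by auto
  have finD: "finite D" using sub assms(1) finite_subset by blast
  \<comment> \<open>In a nonzero term every edge choosing \<open>v\<close> lies in \<open>D\<close>;
    equality of cardinalities then gives all of \<open>D\<close>.\<close>
  have zero: "(\<Prod>e\<in>E. A e (f e)) = 0" if f: "f \<in> assignments E V a - ?S" for f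
  proof (rule ccontr)
    assume nz: "(\<Prod>e\<in>E. A e (f e)) \<noteq> 0"
    have "{e \<in> E. f e = v} \<subseteq> D"
    proof
      fix e assume e: "e \<in> {e \<in> E. f e = v}"
      then have "A e (f e) \<noteq> 0" using nz assms(1) by (auto simp: prod_zero_iff)
      then show "e \<in> D" using e D by auto
    qed
    moreover have "card {e \<in> E. f e = v} = card D" using f assms(3) av by (auto simp: assignments_def)
    ultimately have "{e \<in> E. f e = v} = D" using finD by (simp add: card_subset_eq)
    then show False using f by auto
  qed
  have "coef E V A a = (\<Sum>f\<in>?S. \<Prod>e\<in>E. A e (f e))"
    unfolding coef_def
    by (rule sum.mono_neutral_right) (use zero assms(1,2) finite_assignments in auto)
  also have "\<dots> = (\<Sum>g\<in>assignments (E - D) (V - {v}) a. (\<Prod>e\<in>D. A e v) * (\<Prod>e\<in>E - D. A e (g e)))"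
  proof (rule sum.reindex_bij_witness[where j = "\<lambda>f. restrict f (E - D)"
        and i = "\<lambda>g e. if e \<in> D then v else g e"])
    fix f assume f: "f \<in> ?S"
    then show "(\<lambda>e. if e \<in> D then v else restrict f (E - D) e) = f"
      using sub by (auto simp: fun_eq_iff assignments_def PiE_def extensional_def)
    have "{e \<in> E - D. restrict f (E - D) e = w} = {e \<in> E. f e = w}" if "w \<noteq> v" for w
      using f that by auto
    then have "card {e \<in> E - D. restrict f (E - D) e = w} = a w" if "w \<in> V - {v}" for w
      using f that by (auto simp: assignments_def)
    moreover have "restrict f (E - D) \<in> E - D \<rightarrow>\<^sub>E V - {v}"
      using f by (auto simp: assignments_def)
    ultimately show "restrict f (E - D) \<in> assignments (E - D) (V - {v}) a"
      unfolding assignments_def by blast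
    have "(\<Prod>e\<in>E. A e (f e)) = (\<Prod>e\<in>E - D. A e (f e)) * (\<Prod>e\<in>D. A e (f e))"
      by (rule prod.subset_diff[OF sub assms(1)])
    moreover have "(\<Prod>e\<in>D. A e (f e)) = (\<Prod>e\<in>D. A e v)"
      using f sub by (intro prod.cong) auto
    ultimately show "(\<Prod>e\<in>D. A e v) * (\<Prod>e\<in>E - D. A e (restrict f (E - D) e)) = (\<Prod>e\<in>E. A e (f e))"
      by simp
  next
    fix g assume g: "g \<in> assignments (E - D) (V - {v}) a"
    let ?f = "\<lambda>e. if e \<in> D then v else g e"
    show "restrict ?f (E - D) = g"
      using g by (auto simp: fun_eq_iff assignments_def PiE_def extensional_def)
    have ne: "g e \<noteq> v" if "e \<in> E - D" for e
      using g that by (auto simp: assignments_def)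
    have "{e \<in> E. ?f e = v} = D" using sub ne by auto
    moreover have "{e \<in> E. ?f e = w} = {e \<in> E - D. g e = w}" if "w \<noteq> v" for w using that by auto
    ultimately have "card {e \<in> E. ?f e = w} = a w" if "w \<in> V" for w
      using g that av by (cases "w = v") (auto simp: assignments_def)
    moreover have "?f \<in> E \<rightarrow>\<^sub>E V"
      using g sub assms(3) by (auto simp: assignments_def PiE_def extensional_def)
    ultimately show "?f \<in> ?S" using ne unfolding assignments_def by auto
  qed
  finally show ?thesis unfolding coef_def by (simp add: sum_distrib_left)
qed

text \<open>A nonzero term picks an end of every edge. Picking the other end instead negates each
  factor and turns exponents \<open>a\<close> into \<open>b\<close>, because together the two
  choices use each edge once at each of its ends.\<close>

lemma coef_choose_other_end:
  assumes "finite E" "finite V"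
    and ends: "\<And>e. e \<in> E \<Longrightarrow> tail e \<in> V \<and> head e \<in> V \<and> tail e \<noteq> head e"
    and ab: "\<And>w. w \<in> V \<Longrightarrow> a w + b w = card {e \<in> E. tail e = w \<or> head e = w}"
  shows "coef E V (incidence tail head) a = (-1) ^ card E * coef E V (incidence tail head) b"
proof -
  let ?A = "incidence tail head"
  let ?S = "\<lambda>a. {f \<in> assignments E V a. \<forall>e\<in>E. f e = tail e \<or> f e = head e}"
  let ?other = "\<lambda>f. restrict (\<lambda>e. if f e = tail e then head e else tail e) E"
  have nz: "coef E V ?A a = (\<Sum>f\<in>?S a. \<Prod>e\<in>E. ?A e (f e))" for a
    unfolding coef_def
  proof (rule sum.mono_neutral_right)
    show "\<forall>f\<in>assignments E V a - ?S a. (\<Prod>e\<in>E. ?A e (f e)) = 0"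
      using assms(1) by (auto simp: prod_zero_iff incidence_def)
  qed (use assms(1,2) finite_assignments in auto)
  have inv: "?other (?other f) = f" if "f \<in> ?S c" for f c
    using that ends by (fastforce simp: fun_eq_iff assignments_def PiE_def extensional_def)
  \<comment> \<open>Stated for any complementary exponents \<open>c\<close> and \<open>d\<close>, so
    that it serves both directions of the bijection.\<close>
  have mem: "?other f \<in> ?S d"
    if f: "f \<in> ?S c" and cd: "\<And>w. w \<in> V \<Longrightarrow> c w + d w = card {e \<in> E. tail e = w \<or> head e = w}"
    for f c d
  proof -
    have "card {e \<in> E. ?other f e = w} = d w" if w: "w \<in> V" for w
    proof -
      have f': "f e = tail e \<or> f e = head e" "tail e \<noteq> head e" if "e \<in> E" for e
        using f ends that by auto
      have "{e \<in> E. tail e = w \<or> head e = w} = {e \<in> E. f e = w} \<union> {e \<in> E. ?other f e = w}"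
      proof -
        have "tail e = w \<or> head e = w \<longleftrightarrow> f e = w \<or> ?other f e = w" if "e \<in> E" for e
          using f'[OF that] that by auto
        then show ?thesis by blast
      qed
      moreover have "{e \<in> E. f e = w} \<inter> {e \<in> E. ?other f e = w} = {}"
      proof -
        have "?other f e \<noteq> f e" if "e \<in> E" for e using f'[OF that] that by auto
        then show ?thesis by blast
      qed
      ultimately have "card {e \<in> E. tail e = w \<or> head e = w} =
          card {e \<in> E. f e = w} + card {e \<in> E. ?other f e = w}"
        using assms(1) card_Un_disjoint[of "{e \<in> E. f e = w}" "{e \<in> E. ?other f e = w}"] by simp
      moreover have "card {e \<in> E. f e = w} = c w" using f w by (auto simp: assignments_def)
      ultimately show ?thesis using cd[OF w] by simp
    qed
    then show ?thesis using ends unfolding assignments_def by auto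
  qed
  have "coef E V ?A a = (\<Sum>f\<in>?S b. (-1) ^ card E * (\<Prod>e\<in>E. ?A e (f e)))"
    unfolding nz
  proof (rule sum.reindex_bij_witness[where i = ?other and j = ?other])
    fix f assume f: "f \<in> ?S a"
    then show "?other (?other f) = f" by (rule inv)
    show "?other f \<in> ?S b" using f ab by (rule mem)
    have "(\<Prod>e\<in>E. ?A e (f e)) = (\<Prod>e\<in>E. (-1) * ?A e (?other f e))"
    proof (rule prod.cong[OF refl])
      fix e assume e: "e \<in> E"
      then show "?A e (f e) = (-1) * ?A e (?other f e)"
        using f ends[OF e] by (auto simp: incidence_def)
    qed
    also have "\<dots> = (-1) ^ card E * (\<Prod>e\<in>E. ?A e (?other f e))"
      by (simp only: prod.distrib prod_constant)
    finally show "(-1) ^ card E * (\<Prod>e\<in>E. ?A e (?other f e)) = (\<Prod>e\<in>E. ?A e (f e))" ..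
  next
    fix f assume f: "f \<in> ?S b"
    then show "?other (?other f) = f" by (rule inv)
    show "?other f \<in> ?S a" using f by (rule mem) (use ab in \<open>simp add: add.commute\<close>)
  qed
  then show ?thesis unfolding nz by (simp add: sum_distrib_left)
qed

section \<open>Orientations and degrees of loopless multigraphs\<close>

lemma exists_orientation: "\<exists>tail head. orientation G tail head"
proof -
  have "\<forall>e. \<exists>p. ends G e = Upair (fst p) (snd p)"
    by (metis fst_conv snd_conv uprod_exhaust)
  then obtain p where "\<forall>e. ends G e = Upair (fst (p e)) (snd (p e))" by metis
  then have "orientation G (fst \<circ> p) (snd \<circ> p)" by (simp add: orientation_def)
  then show ?thesis by blast
qed

lemma loopless_orientation_ends:
  assumes "finite_multigraph G" "loopless G" "orientation G tail head" "e \<in> edges G"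
  shows "set_uprod (ends G e) = {tail e, head e}" "tail e \<in> verts G" "head e \<in> verts G"
    "tail e \<noteq> head e"
proof -
  have e: "ends G e = Upair (tail e) (head e)" using assms by (simp add: orientation_def)
  then show *: "set_uprod (ends G e) = {tail e, head e}" by simp
  have "set_uprod (ends G e) \<subseteq> verts G" using assms by (auto simp: finite_multigraph_def)
  then show "tail e \<in> verts G" "head e \<in> verts G" unfolding * by auto
  have "proper_uprod (ends G e)" using assms by (simp add: loopless_def)
  then show "tail e \<noteq> head e" using e by simp
qed

lemma loopless_degree:
  assumes "loopless G"
  shows "degree G w = card {e \<in> edges G. w \<in> set_uprod (ends G e)}"
proof -
  have "{e \<in> edges G. ends G e = Upair w w} = {}" using assms by (auto simp: loopless_def)
  then have "card {e \<in> edges G. ends G e = Upair w w} = 0" by (simp only: card.empty)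
  then show ?thesis unfolding degree_def by simp
qed

text \<open>Double counting of incidences. For a \<open>2 * k\<close>-regular graph this makes the
  number of edges \<open>k\<close> times the number of vertices.\<close>

lemma loopless_handshake:
  assumes "finite_multigraph G" "loopless G"
  shows "(\<Sum>w\<in>verts G. degree G w) = 2 * card (edges G)"
proof -
  obtain tail head where ori: "orientation G tail head" using exists_orientation by blast
  have fin: "finite (verts G)" "finite (edges G)" using assms(1) by (auto simp: finite_multigraph_def)
  have "(\<Sum>w\<in>verts G. degree G w) = (\<Sum>w\<in>verts G. \<Sum>e | e \<in> edges G \<and> w \<in> set_uprod (ends G e). 1)"
    using loopless_degree[OF assms(2)] by simp
  also have "\<dots> = (\<Sum>e\<in>edges G. \<Sum>w | w \<in> verts G \<and> w \<in> set_uprod (ends G e). 1)"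
    using fin by (rule sum.swap_restrict)
  also have "\<dots> = (\<Sum>e\<in>edges G. 2)"
  proof (rule sum.cong[OF refl])
    fix e assume "e \<in> edges G"
    note * = loopless_orientation_ends[OF assms ori this]
    then have "{w. w \<in> verts G \<and> w \<in> set_uprod (ends G e)} = {tail e, head e}" by auto
    then show "(\<Sum>w | w \<in> verts G \<and> w \<in> set_uprod (ends G e). 1) = (2::nat)" using *(4) by simp
  qed
  finally show ?thesis by simp
qed

section \<open>Decompletions\<close>

text \<open>With \<open>v'\<close> as special vertex its exponent is 0. The \<open>2 * k\<close>
  edges at \<open>v\<close> are put back by giving \<open>v\<close> the exponent
  \<open>2 * k\<close>, which costs only a sign.\<close>

lemma graph_permanent_delete_vertex:
  assumes G: "finite_multigraph G" "loopless G" "regular (2 * k) G"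
    and v: "v \<in> verts G" "v' \<in> verts G" "v \<noteq> v'" and ori: "orientation G tail head"
  shows "graph_permanent k (delete_vertex G v) = pm_residue (int k + 1)
    ((\<Prod>w\<in>verts G - {v, v'}. fact k) *
     coef (edges G) (verts G) (incidence tail head) ((\<lambda>_. k)(v := 2 * k, v' := 0)))"
proof -
  let ?H = "delete_vertex G v" and ?A = "incidence tail head"
  let ?D = "{e \<in> edges G. v \<in> set_uprod (ends G e)}"
  let ?a = "(\<lambda>_. k)(v := 2 * k, v' := 0)"
  let ?F = "\<Prod>w\<in>verts G - {v, v'}. fact k :: int"
  have fin: "finite (verts G)" "finite (edges G)" using G(1) by (auto simp: finite_multigraph_def)
  note ends = loopless_orientation_ends[OF G(1,2) ori]
  have H: "verts ?H = verts G - {v}" "edges ?H = edges G - ?D" "ends ?H = ends G"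
    by (auto simp: delete_vertex_def)
  have cD: "card ?D = 2 * k"
    using G(3) v(1) loopless_degree[OF G(2), of v] by (simp add: regular_def)
  have "2 * k * card (verts G) = 2 * card (edges G)"
    using loopless_handshake[OF G(1,2)] G(3) by (simp add: regular_def mult.commute)
  \<comment> \<open>Deleting \<open>v\<close> removes \<open>2 * k\<close> edges, one
    \<open>k\<close> for the vertex \<open>v\<close> and one for the special vertex.\<close>
  then have "card (edges ?H) = k * card (verts G) - 2 * k"
    unfolding H using fin cD by (subst card_Diff_subset) auto
  also have "\<dots> = k * (card (verts ?H) - 1)"
    unfolding H using fin v(1) by (simp add: diff_mult_distrib2 mult.commute)
  finally have card: "card (edges ?H) = k * (card (verts ?H) - 1)" .
  have finH: "finite_multigraph ?H"
    using G(1) unfolding finite_multigraph_def H by blast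
  have oriH: "orientation ?H tail head" using ori unfolding orientation_def H by blast
  have v'H: "v' \<in> verts ?H" using v H by auto
  have D: "?D = {e \<in> edges G. ?A e v \<noteq> 0}"
  proof -
    have "v \<in> set_uprod (ends G e) \<longleftrightarrow> ?A e v \<noteq> 0" if "e \<in> edges G" for e
      using ends(1,4)[OF that] by (auto simp: incidence_def)
    then show ?thesis by blast
  qed
  have "graph_permanent k ?H = pm_residue (int k + 1)
      (weighted_coef (edges ?H) (verts ?H - {v'}) ?A (\<lambda>_. k))"
    using graph_permanent_eq[OF finH oriH v'H card] .
  also have "weighted_coef (edges ?H) (verts ?H - {v'}) ?A (\<lambda>_. k) =
      weighted_coef (edges ?H) (verts ?H) ?A ((\<lambda>_. k)(v' := 0))"
    using weighted_coef_drop_vertex[OF _ _ v'H, of "edges ?H" ?A "\<lambda>_. k"] fin unfolding H by simp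
  also have "\<dots> = weighted_coef (edges ?H) (verts ?H) ?A ?a"
    by (rule weighted_coef_cong) (auto simp: H)
  \<comment> \<open>The weight is split off before \<open>v\<close> returns, so that no factor
    \<open>fact (2 * k)\<close> enters; \<open>v'\<close> contributes \<open>fact 0\<close>.\<close>
  also have "\<dots> = ?F * coef (edges ?H) (verts ?H) ?A ?a"
  proof -
    have "(\<Prod>w\<in>verts ?H. fact (?a w)) = fact (?a v') * (\<Prod>w\<in>verts ?H - {v'}. fact (?a w) :: int)"
      using fin v'H H by (intro prod.remove) auto
    also have "\<dots> = ?F"
      unfolding H by (simp only: fun_upd_same fact_0 mult_1) (intro prod.cong, auto)
    finally show ?thesis unfolding weighted_coef_def by simp
  qed
  also have "pm_residue (int k + 1) \<dots> = pm_residue (int k + 1) (?F * coef (edges G) (verts G) ?A ?a)"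
  proof (rule pm_residue_cong)
    let ?c = "\<Prod>e\<in>?D. ?A e v"
    show c: "?c \<in> {1, -1}"
      by (rule prod_signs) (use ends(1,4) in \<open>auto simp: incidence_def\<close>)
    have sat: "coef (edges G) (verts G) ?A ?a = ?c * coef (edges ?H) (verts ?H) ?A ?a"
      unfolding H
      by (rule coef_saturated_vertex[where A = ?A and a = ?a, OF fin(2,1) v(1) D]) (use cD v(3) in simp)
    \<comment> \<open>The sign is its own inverse, so \<open>sat\<close> can be solved for the
      coefficient of the decompletion.\<close>
    have "?c * (?F * coef (edges G) (verts G) ?A ?a) =
        (?c * ?c) * (?F * coef (edges ?H) (verts ?H) ?A ?a)"
      unfolding sat by (simp only: mult_ac)
    also have "?c * ?c = 1" using c by auto
    finally show "int k + 1 dvd ?F * coef (edges ?H) (verts ?H) ?A ?a -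
        ?c * (?F * coef (edges G) (verts G) ?A ?a)" by (simp only: mult_1 diff_self dvd_0_right)
  qed
  finally show ?thesis .
qed

theorem theorem4p3:
  fixes k :: nat and \<Gamma> :: "('v, 'e) multigraph" and v v' :: 'v
  assumes "k \<ge> 1"
    and "finite_multigraph \<Gamma>"
    and "connected_graph \<Gamma>"
    and "loopless \<Gamma>"
    and "regular (2 * k) \<Gamma>"
    and "v \<in> verts \<Gamma>" and "v' \<in> verts \<Gamma>"
  shows "graph_permanent k (delete_vertex \<Gamma> v) = graph_permanent k (delete_vertex \<Gamma> v')"
proof (cases "v = v'")
  case False
  let ?E = "edges \<Gamma>" and ?V = "verts \<Gamma>"
  obtain tail head where ori: "orientation \<Gamma> tail head" using exists_orientation by blast
  let ?A = "incidence tail head"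
  let ?a = "\<lambda>v v'. (\<lambda>_. k)(v := 2 * k, v' := 0)"
  let ?F = "\<Prod>w\<in>?V - {v, v'}. fact k :: int"
  have fin: "finite ?E" "finite ?V" using assms(2) by (auto simp: finite_multigraph_def)
  note ends = loopless_orientation_ends[OF assms(2,4) ori]
  have deg: "card {e \<in> ?E. tail e = w \<or> head e = w} = 2 * k" if "w \<in> ?V" for w
  proof -
    have "{e \<in> ?E. tail e = w \<or> head e = w} = {e \<in> ?E. w \<in> set_uprod (ends \<Gamma> e)}"
      using ends(1) by auto
    then show ?thesis
      using assms(5) that loopless_degree[OF assms(4), of w] by (simp add: regular_def)
  qed
  \<comment> \<open>The exponents are complementary: \<open>2 * k + 0\<close> at \<open>v\<close>
    and \<open>v'\<close>, \<open>k + k\<close> elsewhere, always the degree.\<close>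
  have flip: "coef ?E ?V ?A (?a v v') = (-1) ^ card ?E * coef ?E ?V ?A (?a v' v)"
  proof (rule coef_choose_other_end[OF fin])
    show "tail e \<in> ?V \<and> head e \<in> ?V \<and> tail e \<noteq> head e" if "e \<in> ?E" for e
      using ends(2-4)[OF that] by simp
    show "?a v v' w + ?a v' v w = card {e \<in> ?E. tail e = w \<or> head e = w}" if "w \<in> ?V" for w
      using deg[OF that] False by simp
  qed
  have "graph_permanent k (delete_vertex \<Gamma> v) = pm_residue (int k + 1) (?F * coef ?E ?V ?A (?a v v'))"
    using graph_permanent_delete_vertex[OF assms(2,4,5,6,7) False ori] .
  \<comment> \<open>The weight \<open>?F\<close> is symmetric in \<open>v\<close> and
    \<open>v'\<close>, so only the sign from \<open>flip\<close> has to be absorbed.\<close>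
  also have "\<dots> = pm_residue (int k + 1) (?F * coef ?E ?V ?A (?a v' v))"
  proof (rule pm_residue_cong)
    show "(-1) ^ card ?E \<in> {1, -1 :: int}" by (cases "even (card ?E)") auto
  qed (simp add: flip mult.left_commute)
  also have "\<dots> = graph_permanent k (delete_vertex \<Gamma> v')"
    using graph_permanent_delete_vertex[OF assms(2,4,5,7,6) False[symmetric] ori]
    by (simp add: insert_commute)
  finally show ?thesis .
qed simp

end
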